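(* For any integers $d\geq 2$, $n\geq 1$ and $m\geq 2$, the generalized Kautz digraph $GK(d,d^mn)$ satisfies: 1. $Z(GK(d,d^mn))=(d-1)d^{m-1}n$; 2. $M(GK(d,d^mn))=(d-1)d^{m-1}n$; 3. $\mathrm{mr}(GK(d,d^mn))=d^{m-1}n$; 4. $\gamma_P(GK(d,d^mn))=(d-1)d^{m-2}n$.
   Context: Generalized Kautz (Imase–Itoh) digraph: for integers $d\geq 2$ and $N\geq 1$, $GK(d,N)$ has vertex set $\mathbb Z_N$, and each vertex $x$ has arcs to the vertices $(-dx-t)\bmod N$ for $t\in\{1,2,\dots,d\}$. A digraph $H$ has vertex set $V(H)$ and arc set $A(H)\subseteq V(H)\times V(H)$; loops are allowed. $N^+_H(v)=\{u:(v,u)\in A(H)\}$, $N^+_H[v]=N^+_H(v)\cup\{v\}$, $N^+_H[S]=\bigcup_{v\in S}N^+_H[v]$. Zero forcing in a digraph $H$: for non-empty $S\subseteq V(H)$ put $B^0(S)=S$ and, for $i\ge 0$: if $H$ has no loops, $B^{i+1}(S)=B^i(S)\cup\{v\in V(H)\setminus B^i(S):\exists u\in B^i(S),\ N^+_H(u)\setminus B^i(S)=\{v\}\}$; if $H$ has at least one loop, $B^{i+1}(S)=B^i(S)\cup\{v\in V(H)\setminus B^i(S):\exists u\in V(H),\ N^+_H(u)\setminus B^i(S)=\{v\}\}$. $S$ is a zero forcing set if $B^k(S)=V(H)$ for some $k\ge 0$. $Z(H)$ is the minimum cardinality of a zero forcing set of $H$. Power domination in $H$: for non-empty $S\subseteq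 V(H)$ put $P^0(S)=S$, $P^1(S)=N^+_H[S]$, and for $i\geq 1$ obtain $P^{i+1}(S)$ from $P^i(S)$ by the same rule by which $B^{i+1}(S)$ is obtained from $B^i(S)$ (the loopless rule if $H$ has no loops, the other rule if $H$ has at least one loop). $S$ is a power dominating set if $P^k(S)=V(H)$ for some $k\ge 0$. $\gamma_P(H)$ is the minimum cardinality of a power dominating set of $H$. Maximum nullity and minimum rank: for a digraph $H$ of order $p$, let $\mathcal S(H)$ be the set of real $p\times p$ matrices $X$ such that: if $H$ has no loops, for all $i\neq j$, $X_{i,j}\neq 0\Leftrightarrow (i,j)\in A(H)$ (diagonal arbitrary); if $H$ has at least one loop, for all $i,j$, $X_{i,j}\neq 0\Leftrightarrow (i,j)\in A(H)$. $M(H)=\max\{\dim\ker X:X\in\mathcal S(H)\}$ and $\mathrm{mr}(H)=\min\{\operatorname{rank}X:X\in\mathcal S(H)\}$. *)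

theory Defs
  imports
    "Graph_Theory.Pair_Digraph"
    "Jordan_Normal_Form.Matrix_Kernel"
    "Jordan_Normal_Form.DL_Rank"
begin

definition generalized_kautz :: "nat \<Rightarrow> nat \<Rightarrow> nat pair_pre_digraph" where
  "generalized_kautz d N =
    \<lparr> pverts = {0..<N},
      parcs = {(x, y). x \<in> {0..<N} \<and> y \<in> {0..<N} \<and>
                 (\<exists>t\<in>{1..d}. int y = (- int d * int x - int t) mod int N)} \<rparr>"

definition has_loops :: "'a pair_pre_digraph \<Rightarrow> bool" where
  "has_loops H \<longleftrightarrow> (\<exists>v\<in>pverts H. (v, v) \<in> parcs H)"

definition out_nbrs :: "'a pair_pre_digraph \<Rightarrow> 'a \<Rightarrow> 'a set" where
  "out_nbrs H v = {u. (v, u) \<in> parcs H}"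

definition closed_out_nbrs :: "'a pair_pre_digraph \<Rightarrow> 'a set \<Rightarrow> 'a set" where
  "closed_out_nbrs H S = (\<Union>v\<in>S. out_nbrs H v \<union> {v})"

text \<open>In a digraph with loops a vertex may force without being coloured itself.\<close>

definition force_step :: "'a pair_pre_digraph \<Rightarrow> 'a set \<Rightarrow> 'a set" where
  "force_step H B = B \<union>
     {v \<in> pverts H - B.
        \<exists>u \<in> (if has_loops H then pverts H else B). out_nbrs H u - B = {v}}"

fun forcing_seq :: "'a pair_pre_digraph \<Rightarrow> 'a set \<Rightarrow> nat \<Rightarrow> 'a set" where
  "forcing_seq H S 0 = S"
| "forcing_seq H S (Suc i) = force_step H (forcing_seq H S i)"

definition zero_forcing_set :: "'a pair_pre_digraph \<Rightarrow> 'a set \<Rightarrow> bool" where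
  "zero_forcing_set H S \<longleftrightarrow>
     S \<noteq> {} \<and> S \<subseteq> pverts H \<and> (\<exists>k. forcing_seq H S k = pverts H)"

definition zero_forcing_number :: "'a pair_pre_digraph \<Rightarrow> nat" where
  "zero_forcing_number H = Min {card S | S. zero_forcing_set H S}"

fun power_seq :: "'a pair_pre_digraph \<Rightarrow> 'a set \<Rightarrow> nat \<Rightarrow> 'a set" where
  "power_seq H S 0 = S"
| "power_seq H S (Suc 0) = closed_out_nbrs H S"
| "power_seq H S (Suc (Suc i)) = force_step H (power_seq H S (Suc i))"

definition power_dominating_set :: "'a pair_pre_digraph \<Rightarrow> 'a set \<Rightarrow> bool" where
  "power_dominating_set H S \<longleftrightarrow>
     S \<noteq> {} \<and> S \<subseteq> pverts H \<and> (\<exists>k. power_seq H S k = pverts H)"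

definition power_domination_number :: "'a pair_pre_digraph \<Rightarrow> nat" where
  "power_domination_number H = Min {card S | S. power_dominating_set H S}"

text \<open>
  Matrix rows and columns are numbered from \<open>0\<close>, so the definitions below are meant for
  digraphs of order \<open>p\<close> with vertex set \<open>{0..<p}\<close>; the vertices are the indices.
\<close>

definition digraph_matrices :: "nat pair_pre_digraph \<Rightarrow> real mat set" where
  "digraph_matrices H =
    {X \<in> carrier_mat (card (pverts H)) (card (pverts H)).
       \<forall>i\<in>pverts H. \<forall>j\<in>pverts H.
         has_loops H \<or> i \<noteq> j \<longrightarrow> (X $$ (i, j) \<noteq> 0 \<longleftrightarrow> (i, j) \<in> parcs H)}"

definition max_nullity :: "nat pair_pre_digraph \<Rightarrow> nat" where
  "max_nullity H = Max {kernel_dim X | X. X \<in> digraph_matrices H}"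

definition min_rank :: "nat pair_pre_digraph \<Rightarrow> nat" where
  "min_rank H = Min {vec_space.rank (card (pverts H)) X | X. X \<in> digraph_matrices H}"

end

theory Submission
  imports Defs "HOL-Number_Theory.Cong"
begin

text \<open>
  Put \<open>M = d ^ (m - 1) * n\<close>. The \<open>d\<close> out-neighbours of a vertex \<open>x\<close> of \<open>GK(d, d * M)\<close> are
  consecutive and form a whole block \<open>{d * b, \<dots>, d * b + d - 1}\<close>, namely the one with index
  \<open>b = M - 1 - x mod M\<close>. So the vertex set splits into \<open>M\<close> blocks, and two vertices of one block
  have the same in-neighbours.

  Two uncoloured vertices with the same in-neighbours can never be forced, because whoever could
  force one of them sees both. Hence a zero forcing set misses at most one vertex of each block,
  which bounds \<open>Z\<close> below by \<open>(d - 1) * M\<close>. Conversely, omit one vertex from each block in such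
  a way that every block keeps a coloured in-neighbour: then everything is forced in a single step,
  with or without loops. The forcing vertices (as rows) and the forced vertices (as columns) span an
  \<open>M\<close> by \<open>M\<close> diagonal submatrix with nonzero diagonal in every matrix of the digraph. A forcing
  vertex is coloured and a forced one is not, so the diagonal entries of the matrix, which are
  arbitrary if there are no loops, do not occur in it. This gives rank at least \<open>M\<close>,
  and the adjacency matrix, which has only \<open>M\<close> distinct columns, attains it. The nullity follows from the rank-nullity theorem.

  For power domination write \<open>M = d * Q\<close>. A power dominating set \<open>S\<close> dominates at most \<open>card S\<close>
  blocks by out-neighbourhoods and must contain at least \<open>d - 1\<close> vertices of every other block;
  so \<open>(d - 1) * (M - card S) \<le> card S\<close>, that is, \<open>card S \<ge> (d - 1) * Q\<close>. To attain the bound,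
  take a set \<open>C\<close> of \<open>Q\<close> blocks and \<open>d - 1\<close> vertices in each of them whose
  out-neighbourhoods are precisely the blocks outside \<open>C\<close>.
  Which blocks the vertices of block \<open>b\<close> point to depends only on \<open>b mod Q\<close>: they are the \<open>d\<close> blocks \<open>c\<close> with \<open>c div d = Q - 1 - b mod Q\<close>. It therefore
  suffices that \<open>C\<close> contains one element of each residue class modulo \<open>Q\<close> and one of each
  interval \<open>{d * i, \<dots>, d * i + d - 1}\<close> with \<open>i < Q\<close>; such a common transversal exists
  (\<open>common_transversal\<close>). The remaining vertex of each block of \<open>C\<close> is forced in the next step.
\<close>

section \<open>Rank and nullity\<close>

lemma rank_plus_kernel_dim:
  fixes A :: "'a :: field mat"
  assumes A: "A \<in> carrier_mat nr nc"
  shows "vec_space.rank nr A + kernel_dim A = nc"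
proof -
  interpret kernel nr nc A by unfold_locales (rule A)
  interpret W: vec_space "TYPE('a)" nr .
  interpret L: linear_map class_ring "module_vec TYPE('a) nc" "module_vec TYPE('a) nr"
      "\<lambda>v. A *\<^sub>v v"
    by unfold_locales
      (use A in \<open>auto simp: module_vec_simps module_hom_def mult_add_distrib_mat_vec mult_mat_vec\<close>)
  have im: "L.im = W.span (set (cols A))"
    using W.col_space_eq[OF A] A by (auto simp: L.im_def W.col_space_def module_vec_simps)
  have ker: "L.ker = mat_kernel A"
    using A by (auto simp: L.ker_def mat_kernel module_vec_simps)
  show ?thesis
    using L.rank_nullity[OF NC.fin_dim] im ker kernel_dim NC.dim_is_n
    unfolding W.rank_def by simp
qed

lemma (in vec_space) rank_le_card_cols:
  assumes A: "A \<in> carrier_mat n nc"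
  shows "rank A \<le> card (set (cols A))"
proof -
  obtain S where S: "maximal S (\<lambda>T. T \<subseteq> set (cols A) \<and> lin_indpt T)"
    using maximal_exists[of "\<lambda>T. T \<subseteq> set (cols A) \<and> lin_indpt T" "card (set (cols A))" "{}"]
    by (meson List.finite_set card_mono empty_iff empty_subsetI finite_lin_indpt2 rev_finite_subset)
  then have "card S \<le> card (set (cols A))"
    by (simp add: card_mono maximal_def)
  then show ?thesis
    using rank_card_indpt[OF A S] by simp
qed

text \<open>
  Column \<open>c i\<close> is the only one of the chosen columns that does not vanish in row \<open>r i\<close>, so that
  row isolates its coefficient in any linear relation between them.
\<close>

lemma (in vec_space) rank_ge_diagonal_minor:
  assumes A: "A \<in> carrier_mat n nc" and "finite I"
    and r: "\<And>i. i \<in> I \<Longrightarrow> r i < n" and c: "\<And>i. i \<in> I \<Longrightarrow> c i < nc"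
    and diag: "\<And>i j. i \<in> I \<Longrightarrow> j \<in> I \<Longrightarrow> A $$ (r i, c j) \<noteq> 0 \<longleftrightarrow> i = j"
  shows "card I \<le> rank A"
proof -
  define w where "w j = col A (c j)" for j
  have w: "w j $ r i = A $$ (r i, c j)" if "i \<in> I" "j \<in> I" for i j
    using A r[OF that(1)] c[OF that(2)] by (auto simp: w_def)
  have inj: "inj_on w I"
    by (rule inj_onI) (metis diag w)
  have sub: "w ` I \<subseteq> set (cols A)"
    using A c by (auto simp: w_def cols_def)
  have car: "w ` I \<subseteq> carrier_vec n"
    using A by (auto simp: w_def)
  have zero: "a v = 0" if 0: "lincomb a (w ` I) = 0\<^sub>v n" and v: "v \<in> w ` I" for a v
  proof -
    from v obtain i where i: "i \<in> I" "v = w i" by blast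
    have "0 = lincomb a (w ` I) $ r i"
      using 0 r[OF i(1)] by simp
    also have "\<dots> = (\<Sum>x\<in>w ` I. a x * x $ r i)"
      by (rule lincomb_index[OF r[OF i(1)] car])
    also have "\<dots> = (\<Sum>j\<in>I. a (w j) * w j $ r i)"
      using inj by (simp add: sum.reindex)
    also have "\<dots> = (\<Sum>j\<in>I. if j = i then a (w i) * w i $ r i else 0)"
      using diag[OF i(1)] by (intro sum.cong) (auto simp: w i)
    also have "\<dots> = a (w i) * w i $ r i"
      using i \<open>finite I\<close> by simp
    finally show "a v = 0"
      using diag[OF i(1) i(1)] w[OF i(1) i(1)] i(2) by simp
  qed
  have "lin_indpt (w ` I)"
    using zero \<open>finite I\<close> car by (intro finite_lin_indpt2) auto
  from rank_ge_card_indpt[OF A sub this] show ?thesis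
    by (simp add: card_image inj)
qed

section \<open>Digraph parameters from an optimal witness\<close>

lemma zero_forcing_number_eqI:
  assumes "finite (pverts H)" "zero_forcing_set H S"
    and "\<And>S'. zero_forcing_set H S' \<Longrightarrow> card S \<le> card S'"
  shows "zero_forcing_number H = card S"
  unfolding zero_forcing_number_def
proof (rule Min_eqI)
  show "finite {card S |S. zero_forcing_set H S}"
    by (rule finite_subset[of _ "card ` Pow (pverts H)"])
       (auto simp: zero_forcing_set_def assms(1))
qed (use assms in auto)

lemma power_domination_number_eqI:
  assumes "finite (pverts H)" "power_dominating_set H S"
    and "\<And>S'. power_dominating_set H S' \<Longrightarrow> card S \<le> card S'"
  shows "power_domination_number H = card S"
  unfolding power_domination_number_def
proof (rule Min_eqI)
  show "finite {card S |S. power_dominating_set H S}"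
    by (rule finite_subset[of _ "card ` Pow (pverts H)"])
       (auto simp: power_dominating_set_def assms(1))
qed (use assms in auto)

text \<open>
  Since rank and nullity add up to the order, a matrix of least rank has the greatest nullity.
\<close>

lemma min_rank_max_nullity_eqI:
  assumes X: "X \<in> digraph_matrices H" "vec_space.rank (card (pverts H)) X \<le> r"
    and least: "\<And>Y. Y \<in> digraph_matrices H \<Longrightarrow> r \<le> vec_space.rank (card (pverts H)) Y"
  shows "min_rank H = r" "max_nullity H = card (pverts H) - r"
proof -
  let ?N = "card (pverts H)"
  have sum: "vec_space.rank ?N Y + kernel_dim Y = ?N" if "Y \<in> digraph_matrices H" for Y
    using that by (intro rank_plus_kernel_dim) (simp add: digraph_matrices_def)
  have rX: "vec_space.rank ?N X = r"
    using X least by (simp add: le_antisym)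
  show "min_rank H = r"
    unfolding min_rank_def
  proof (rule Min_eqI)
    have "vec_space.rank ?N X \<le> ?N" if "X \<in> digraph_matrices H" for X
      using sum[OF that] by linarith
    then show "finite {vec_space.rank ?N X |X. X \<in> digraph_matrices H}"
      by (intro finite_subset[OF _ finite_atMost[of ?N]]) blast
  qed (use least X rX in auto)
  show "max_nullity H = ?N - r"
    unfolding max_nullity_def
  proof (rule Max_eqI)
    have "kernel_dim X \<le> ?N" if "X \<in> digraph_matrices H" for X
      using sum[OF that] by linarith
    then show "finite {kernel_dim X |X. X \<in> digraph_matrices H}"
      by (intro finite_subset[OF _ finite_atMost[of ?N]]) blast
    show "?N - r \<in> {kernel_dim X |X. X \<in> digraph_matrices H}"
      using X(1) rX sum[OF X(1)] by (intro CollectI exI[of _ X]) linarith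
    have "kernel_dim Y \<le> ?N - r" if "Y \<in> digraph_matrices H" for Y
      using sum[OF that] least[OF that] by linarith
    then show "k \<le> ?N - r" if "k \<in> {kernel_dim X |X. X \<in> digraph_matrices H}" for k
      using that by blast
  qed
qed

section \<open>Vertices with equal in-neighbourhoods\<close>

text \<open>
  A vertex adjacent to one of the twins \<open>v\<close>, \<open>w\<close> is adjacent to the other as well, so as long
  as both are uncoloured, neither can be anyone's unique uncoloured out-neighbour.
\<close>

lemma twins_stay_uncoloured:
  assumes "\<And>u. v \<in> out_nbrs H u \<longleftrightarrow> w \<in> out_nbrs H u" "v \<noteq> w" "v \<notin> S" "w \<notin> S"
  shows "v \<notin> forcing_seq H S k \<and> w \<notin> forcing_seq H S k"
proof (induction k)
  case (Suc k)
  have "v \<in> out_nbrs H u - forcing_seq H S k \<longleftrightarrow> w \<in> out_nbrs H u - forcing_seq H S k" for u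
    using assms(1)[of u] Suc by blast
  then have "out_nbrs H u - forcing_seq H S k \<noteq> {v} \<and> out_nbrs H u - forcing_seq H S k \<noteq> {w}" for u
    using assms(2) by (metis singleton_iff)
  with Suc show ?case by (simp add: force_step_def)
qed (use assms in simp)

lemma power_seq_Suc: "power_seq H S (Suc k) = forcing_seq H (closed_out_nbrs H S) k"
  by (induction k) auto

section \<open>Digraphs whose out-neighbourhoods are blocks\<close>

text \<open>
  The blocks are the fibres of \<open>\<lambda>x. x div d\<close>, and \<open>f x\<close> is the index of the block that is the
  out-neighbourhood of \<open>x\<close>.
\<close>

locale block_digraph =
  fixes H :: "nat pair_pre_digraph" and d M :: nat and f :: "nat \<Rightarrow> nat"
  assumes d_pos: "0 < d"
    and pverts_eq: "pverts H = {0..<d * M}"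
    and parcs_eq: "parcs H = {(x, y). x < d * M \<and> y < d * M \<and> y div d = f x}"
begin

lemma div_less_iff [simp]: "x div d < M \<longleftrightarrow> x < d * M"
  using d_pos by (simp add: div_less_iff_less_mult mult.commute)

lemma mem_out_nbrs: "y \<in> out_nbrs H x \<longleftrightarrow> x < d * M \<and> y < d * M \<and> y div d = f x"
  by (simp add: out_nbrs_def parcs_eq)

lemma card_pverts: "card (pverts H) = d * M"
  by (simp add: pverts_eq)

lemma finite_pverts: "finite (pverts H)"
  by (simp add: pverts_eq)

lemma uncoloured_inj_on_blocks:
  assumes "forcing_seq H B k = pverts H"
  shows "inj_on (\<lambda>v. v div d) (pverts H - B)"
proof (rule inj_onI, rule ccontr)
  fix v w assume vw: "v \<in> pverts H - B" "w \<in> pverts H - B" "v div d = w div d" "v \<noteq> w"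
  then have "v \<in> out_nbrs H u \<longleftrightarrow> w \<in> out_nbrs H u" for u
    by (auto simp: mem_out_nbrs pverts_eq)
  from twins_stay_uncoloured[OF this] vw assms show False by blast
qed

text \<open>
  Once at most one vertex per block is missing, any coloured vertex pointing to a block has the
  missing vertex as its only uncoloured out-neighbour. Asking for a coloured forcing vertex serves
  both colour change rules at once.
\<close>

lemma force_step_eq_pverts:
  assumes B: "B \<subseteq> pverts H" and inj: "inj_on (\<lambda>v. v div d) (pverts H - B)"
    and forcer: "\<And>v. v \<in> pverts H - B \<Longrightarrow> \<exists>u\<in>B. f u = v div d"
  shows "force_step H B = pverts H"
proof
  show "pverts H \<subseteq> force_step H B"
  proof
    fix v assume v: "v \<in> pverts H"
    show "v \<in> force_step H B"
    proof (cases "v \<in> B")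
      case False
      with v forcer obtain u where u: "u \<in> B" "f u = v div d" by blast
      have "out_nbrs H u - B = {v}"
      proof (rule subset_antisym; rule subsetI)
        fix w assume "w \<in> out_nbrs H u - B"
        then have "w \<in> pverts H - B" "w div d = v div d"
          using u by (auto simp: mem_out_nbrs pverts_eq)
        with inj v False show "w \<in> {v}" by (auto dest: inj_onD)
      next
        fix w assume "w \<in> {v}"
        with v False u B show "w \<in> out_nbrs H u - B"
          by (auto simp: mem_out_nbrs pverts_eq)
      qed
      with u v False B show ?thesis by (auto simp: force_step_def)
    qed (simp add: force_step_def)
  qed
qed (use B in \<open>auto simp: force_step_def\<close>)

lemma zero_forcing_set_card_ge:
  assumes "zero_forcing_set H S"
  shows "(d - 1) * M \<le> card S"
proof -
  from assms obtain k where S: "S \<subseteq> pverts H" and k: "forcing_seq H S k = pverts H"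
    by (auto simp: zero_forcing_set_def)
  have "card (pverts H - S) \<le> card {0..<M}"
    by (rule card_inj_on_le[OF uncoloured_inj_on_blocks[OF k]]) (auto simp: pverts_eq)
  moreover have "card (pverts H - S) = d * M - card S"
    using S by (metis card_Diff_subset card_pverts finite_atLeastLessThan finite_subset pverts_eq)
  ultimately show ?thesis by (simp add: diff_mult_distrib)
qed

text \<open>
  After the domination step at most one vertex per block may be missing. The blocks in \<open>U\<close>, which
  nobody in \<open>S\<close> points to, are coloured only by their own members in \<open>S\<close>, so \<open>S\<close> contains
  at least \<open>d - 1\<close> vertices of each of them; and there are at least \<open>M - card S\<close> such blocks.
\<close>

lemma power_dominating_set_card_ge:
  assumes "power_dominating_set H S"
  shows "(d - 1) * M \<le> d * card S"
proof -
  define B where "B = closed_out_nbrs H S"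
  from assms obtain k where S: "S \<subseteq> pverts H" and k: "power_seq H S k = pverts H"
    by (auto simp: power_dominating_set_def)
  obtain i where "forcing_seq H B i = pverts H"
  proof (cases k)
    case 0
    with k S have "B = pverts H"
      by (auto simp: B_def closed_out_nbrs_def mem_out_nbrs pverts_eq)
    then have "forcing_seq H B 0 = pverts H" by simp
    then show ?thesis by (rule that)
  next
    case (Suc k')
    with k have "forcing_seq H B k' = pverts H"
      by (simp only: B_def power_seq_Suc)
    then show ?thesis by (rule that)
  qed
  then have inj: "inj_on (\<lambda>v. v div d) (pverts H - B)"
    by (rule uncoloured_inj_on_blocks)
  have finS: "finite S"
    using S finite_pverts by (rule finite_subset)
  define U where "U = {0..<M} - f ` S"
  define W where "W = {x. x div d \<in> U}"
  have finU: "finite U" by (simp add: U_def)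
  have WV: "W \<subseteq> pverts H"
    by (auto simp: W_def U_def pverts_eq)
  then have finW: "finite W"
    using finite_pverts by (rule finite_subset)
  have "bij_betw (\<lambda>x. (x div d, x mod d)) W (U \<times> {0..<d})"
    by (rule bij_betw_byWitness[where f' = "\<lambda>(b, j). d * b + j"])
       (use d_pos in \<open>auto simp: W_def\<close>)
  then have cardW: "card W = d * card U"
    by (simp add: bij_betw_same_card card_cartesian_product mult.commute)
  have "W - S \<subseteq> pverts H - B"
    using WV by (auto simp: W_def U_def B_def closed_out_nbrs_def mem_out_nbrs)
  then have "card (W - S) \<le> card U"
    by (intro card_inj_on_le[OF inj_on_subset[OF inj]] finU) (auto simp: W_def)
  moreover have "card W \<le> card (W - S) + card S"
    using card_mono[of "(W - S) \<union> S" W] card_Un_le[of "W - S" S] finW finS by force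
  ultimately have "d * card U \<le> card U + card S"
    using cardW by linarith
  then have 1: "(d - 1) * card U \<le> card S"
    by (simp add: diff_mult_distrib)
  have "M - card S \<le> card U"
    unfolding U_def using finS card_image_le[OF finS, of f] diff_card_le_card_Diff[of "f ` S" "{0..<M}"]
    by simp
  then have "(d - 1) * (M - card S) \<le> card S"
    using 1 by (meson le_trans mult_le_mono2)
  then have "(d - 1) * M \<le> card S + (d - 1) * card S"
    by (simp add: diff_mult_distrib2)
  also have "\<dots> = d * card S"
    using d_pos by (cases d) auto
  finally show ?thesis .
qed

text \<open>
  The vertex \<open>v b\<close> is the one omitted from block \<open>b\<close>, and \<open>u b\<close> is a vertex that forces it. A
  single choice of \<open>u\<close> and \<open>v\<close> settles all three parameters: the complement of the omitted
  vertices is a zero forcing set, and the rows \<open>u b\<close> and columns \<open>v b\<close> give the diagonal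
  submatrix that bounds the rank from below. No \<open>u a\<close> is an omitted vertex, so this submatrix
  avoids the diagonal, where the matrices of a loopless digraph are unconstrained.
\<close>

lemma zero_forcing_rank_eqs:
  assumes d2: "2 \<le> d" and M: "0 < M"
    and v: "\<And>b. b < M \<Longrightarrow> v b div d = b"
    and u: "\<And>b. b < M \<Longrightarrow> u b < d * M \<and> f (u b) = b \<and> u b \<notin> v ` {0..<M}"
  shows "zero_forcing_number H = (d - 1) * M"
    and "min_rank H = M" and "max_nullity H = (d - 1) * M"
proof -
  have inj_v: "inj_on v {0..<M}"
    by (rule inj_onI) (metis atLeastLessThan_iff v)
  have vV: "v b < d * M" if "b < M" for b
    using v[OF that] that div_less_iff[of "v b"] by simp
  define S where "S = pverts H - v ` {0..<M}"
  have cardS: "card S = (d - 1) * M"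
    unfolding S_def
    using vV by (subst card_Diff_subset)
      (auto simp: card_image[OF inj_v] pverts_eq diff_mult_distrib)
  have VS: "pverts H - S = v ` {0..<M}"
    using vV by (auto simp: S_def pverts_eq)
  have "forcing_seq H S 1 = pverts H"
  proof -
    have "force_step H S = pverts H"
    proof (rule force_step_eq_pverts)
      show "inj_on (\<lambda>v. v div d) (pverts H - S)"
        unfolding VS by (rule inj_onI) (auto simp: v)
      show "\<exists>x\<in>S. f x = y div d" if y: "y \<in> pverts H - S" for y
      proof -
        obtain b where b: "b < M" "y = v b"
          using y unfolding VS by auto
        with u[of b] v[of b] show ?thesis
          by (intro bexI[of _ "u b"]) (auto simp: S_def pverts_eq)
      qed
    qed (simp add: S_def)
    then show ?thesis by simp
  qed
  moreover have "S \<noteq> {}"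
    using cardS d2 M by (intro notI) simp
  ultimately have "zero_forcing_set H S"
    unfolding zero_forcing_set_def using S_def by blast
  with zero_forcing_number_eqI[of H S] zero_forcing_set_card_ge cardS
  show "zero_forcing_number H = (d - 1) * M"
    by (simp add: pverts_eq)

  let ?r = "vec_space.rank (card (pverts H)) :: real mat \<Rightarrow> nat"
  define X :: "real mat" where
    "X = mat (d * M) (d * M) (\<lambda>(x, y). if y div d = f x then 1 else 0)"
  have X: "X \<in> digraph_matrices H"
    by (auto simp: digraph_matrices_def X_def card_pverts pverts_eq parcs_eq)
  have "set (cols X) \<subseteq> (\<lambda>b. vec (d * M) (\<lambda>x. if b = f x then 1 else 0)) ` {0..<M}"
  proof
    fix w assume "w \<in> set (cols X)"
    then obtain y where y: "y < d * M" "w = col X y"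
      by (auto simp: cols_def X_def)
    then have "w = vec (d * M) (\<lambda>x. if y div d = f x then 1 else 0)"
      by (auto simp: X_def)
    with y show "w \<in> (\<lambda>b. vec (d * M) (\<lambda>x. if b = f x then 1 else 0)) ` {0..<M}"
      by (intro image_eqI[of _ _ "y div d"]) auto
  qed
  then have "card (set (cols X)) \<le> card {0..<M}"
    by (intro surj_card_le) auto
  moreover have "?r X \<le> card (set (cols X))"
    by (rule vec_space.rank_le_card_cols[of _ _ "d * M"]) (simp add: X_def card_pverts)
  ultimately have rX: "?r X \<le> M" by simp
  have low: "M \<le> ?r Y" if Y: "Y \<in> digraph_matrices H" for Y
  proof -
    have "card {0..<M} \<le> vec_space.rank (d * M) Y"
    proof (rule vec_space.rank_ge_diagonal_minor[where r = u and c = v and nc = "d * M"])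
      show "Y \<in> carrier_mat (d * M) (d * M)"
        using Y by (simp add: digraph_matrices_def card_pverts)
      fix a b assume ab: "a \<in> {0..<M}" "b \<in> {0..<M}"
      then have "u a \<noteq> v b" using u[of a] by force
      then have "Y $$ (u a, v b) \<noteq> 0 \<longleftrightarrow> (u a, v b) \<in> parcs H"
        using Y u[of a] vV[of b] ab by (auto simp: digraph_matrices_def pverts_eq)
      also have "\<dots> \<longleftrightarrow> a = b"
        using u[of a] vV[of b] v[of b] ab by (auto simp: parcs_eq)
      finally show "Y $$ (u a, v b) \<noteq> 0 \<longleftrightarrow> a = b" .
    qed (use u vV in auto)
    then show ?thesis by (simp add: card_pverts)
  qed
  show "min_rank H = M" "max_nullity H = (d - 1) * M"
    using min_rank_max_nullity_eqI[OF X rX low] by (auto simp: card_pverts diff_mult_distrib)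
qed

end

section \<open>Generalized Kautz digraphs as block digraphs\<close>

text \<open>
  The left-hand side says that \<open>y\<close> is congruent to \<open>- d * x - t\<close> modulo \<open>d * M\<close>. With
  \<open>y = d * b + j\<close> and \<open>j < d\<close>, divisibility by \<open>d\<close> leaves only \<open>t = d - j\<close>, and what remains
  after cancelling \<open>d\<close> is \<open>x + b + 1 \<equiv> 0\<close> modulo \<open>M\<close>.
\<close>

lemma eq_block_index_iff_dvd:
  fixes d M x y :: nat
  assumes "0 < d" "0 < M" and y: "y < d * M"
  shows "(\<exists>t\<in>{1..d}. d * M dvd d * x + y + t) \<longleftrightarrow> y div d = M - 1 - x mod M"
proof -
  define b j where "b = y div d" and "j = y mod d"
  have yb: "y = d * b + j" and j: "j < d" and b: "b < M"
    using assms by (auto simp: b_def j_def less_mult_imp_div_less mult.commute)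
  have key: "d * M dvd d * x + y + t \<longleftrightarrow> M dvd x + b + 1" if "t = d - j" for t
  proof -
    have "d * x + y + t = d * (x + b + 1)"
      using that j by (simp add: yb algebra_simps)
    then show ?thesis
      using \<open>0 < d\<close> by (simp only: nat_mult_dvd_cancel1)
  qed
  have "(\<exists>t\<in>{1..d}. d * M dvd d * x + y + t) \<longleftrightarrow> M dvd x + b + 1"
  proof
    assume "\<exists>t\<in>{1..d}. d * M dvd d * x + y + t"
    then obtain t where t: "1 \<le> t" "t \<le> d" "d * M dvd d * x + y + t" by auto
    then have "d dvd d * x + y + t" by (meson dvd_mult_left)
    moreover have "d * x + y + t = d * (x + b) + (j + t)"
      by (simp add: yb algebra_simps)
    ultimately have "d dvd j + t"
      by (metis dvd_add_right_iff dvd_triv_left)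
    then obtain q where q: "j + t = d * q" by (auto elim: dvdE)
    have "0 < q" using q t(1) by (cases q) auto
    moreover have "d * q < d * 2" using q j t(2) by linarith
    then have "q < 2" by simp
    ultimately have "q = 1" by simp
    with q have "t = d - j" by simp
    from key[OF this] t(3) show "M dvd x + b + 1" by simp
  next
    assume "M dvd x + b + 1"
    with key[of "d - j"] j show "\<exists>t\<in>{1..d}. d * M dvd d * x + y + t"
      by (intro bexI[of _ "d - j"]) auto
  qed
  also have "\<dots> \<longleftrightarrow> M dvd x mod M + b + 1"
    by (metis add.assoc dvd_eq_mod_eq_0 mod_add_left_eq)
  also have "\<dots> \<longleftrightarrow> b = M - 1 - x mod M"
  proof
    assume "M dvd x mod M + b + 1"
    then obtain q where q: "x mod M + b + 1 = M * q" by (auto elim: dvdE)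
    have "0 < q" using q by (cases q) auto
    moreover have "x mod M < M" using \<open>0 < M\<close> by simp
    then have "M * q < M * 2" using q b by linarith
    then have "q < 2" by simp
    ultimately have "q = 1" by simp
    with q show "b = M - 1 - x mod M" by simp
  next
    assume "b = M - 1 - x mod M"
    moreover have "x mod M < M" using \<open>0 < M\<close> by simp
    ultimately have "x mod M + b + 1 = M" by simp
    then show "M dvd x mod M + b + 1" by simp
  qed
  finally show ?thesis by (simp add: b_def)
qed

lemma generalized_kautz_block_digraph:
  assumes "0 < d" "0 < M"
  shows "block_digraph (generalized_kautz d (d * M)) d M (\<lambda>x. M - 1 - x mod M)"
proof
  have "(\<exists>t\<in>{1..d}. int y = (- int d * int x - int t) mod int (d * M))
      \<longleftrightarrow> y div d = M - 1 - x mod M" if y: "y < d * M" for x y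
  proof -
    have "int y = (- int d * int x - int t) mod int (d * M) \<longleftrightarrow> d * M dvd d * x + y + t" for t
    proof -
      have "int y = (- int d * int x - int t) mod int (d * M)
          \<longleftrightarrow> int y mod int (d * M) = (- int d * int x - int t) mod int (d * M)"
        using y by (subst mod_pos_pos_trivial[of "int y"]) (simp_all flip: of_nat_mult)
      also have "\<dots> \<longleftrightarrow> int (d * M) dvd int y - (- int d * int x - int t)"
        by (rule mod_eq_dvd_iff)
      also have "int y - (- int d * int x - int t) = int (d * x + y + t)"
        by simp
      finally show ?thesis by (simp only: int_dvd_int_iff)
    qed
    then show ?thesis
      using eq_block_index_iff_dvd[OF assms y] by simp
  qed
  then show "parcs (generalized_kautz d (d * M)) =
      {(x, y). x < d * M \<and> y < d * M \<and> y div d = M - 1 - x mod M}"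
    by (auto simp: generalized_kautz_def)
qed (use assms in \<open>simp_all add: generalized_kautz_def\<close>)

section \<open>A common transversal\<close>

text \<open>
  The set \<open>C\<close> takes one element from each interval \<open>{d * b, \<dots>, d * b + d - 1}\<close>. The multiples
  \<open>d * b\<close> themselves would repeat modulo \<open>Q\<close> with period \<open>q = Q div g\<close>, where
  \<open>g = gcd d Q\<close>, and their residues are multiples of \<open>g\<close>. Shifting \<open>d * b\<close> by the number
  \<open>b div q\<close> of completed periods, which is less than \<open>g\<close>, separates the repetitions, and the shift
  can be read off modulo \<open>g\<close>.
\<close>

lemma common_transversal:
  fixes d Q :: nat
  assumes "0 < d" "0 < Q"
  obtains C where "C \<subseteq> {0..<d * Q}"
    "bij_betw (\<lambda>c. c div d) C {0..<Q}" "bij_betw (\<lambda>c. c mod Q) C {0..<Q}"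
proof
  define g where "g = gcd d Q"
  define e q where "e = d div g" and "q = Q div g"
  have g: "0 < g" using assms by (simp add: g_def)
  have d: "d = g * e" and Q: "Q = g * q"
    by (simp_all add: e_def q_def g_def)
  have cop: "coprime e q"
    using assms by (auto simp: e_def q_def g_def intro: div_gcd_coprime)
  have q: "0 < q" and e: "0 < e" using assms d Q by (auto intro: Nat.gr0I)
  define c where "c b = d * b + b div q" for b
  have off: "b div q < g" if "b < Q" for b
    using that by (simp add: Q less_mult_imp_div_less)
  have "g \<le> d" using d e by simp
  have cdiv: "c b div d = b" if "b < Q" for b
    using off[OF that] \<open>g \<le> d\<close> \<open>0 < d\<close> by (simp add: c_def)
  show "c ` {0..<Q} \<subseteq> {0..<d * Q}"
  proof clarify
    fix b assume "b \<in> {0..<Q}"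
    then have "c b div d < Q" using cdiv by simp
    then show "c b \<in> {0..<d * Q}"
      using \<open>0 < d\<close> by (simp add: div_less_iff_less_mult mult.commute)
  qed
  show "bij_betw (\<lambda>c. c div d) (c ` {0..<Q}) {0..<Q}"
    by (rule bij_betw_byWitness[where f' = c]) (auto simp: cdiv)
  have inj: "a = b" if ab: "a < Q" "b < Q" and eq: "c a mod Q = c b mod Q" for a b
  proof -
    have "[c a = c b] (mod Q)" using eq by (simp add: cong_def)
    then have "[c a = c b] (mod g)" by (rule cong_dvd_modulus_nat) (simp add: Q)
    then have "[a div q = b div q] (mod g)"
      by (simp add: c_def cong_def d mult.assoc)
    then have 1: "a div q = b div q"
      using off[OF ab(1)] off[OF ab(2)] by (simp add: cong_def)
    with \<open>[c a = c b] (mod Q)\<close> have "[d * a = d * b] (mod Q)"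
      by (simp add: c_def cong_add_rcancel_nat)
    then have "[g * (e * a) = g * (e * b)] (mod (g * q))"
      by (simp add: d Q mult.assoc)
    then have "[e * a = e * b] (mod q)"
      using g by (simp add: cong_def mod_mult_mult1)
    then have "[a = b] (mod q)"
      using cop by (simp add: cong_mult_lcancel_nat)
    then have "a mod q = b mod q" by (simp add: cong_def)
    have "a = a div q * q + a mod q" by simp
    also have "\<dots> = b div q * q + b mod q"
      by (simp only: 1 \<open>a mod q = b mod q\<close>)
    also have "\<dots> = b" by simp
    finally show "a = b" .
  qed
  show "bij_betw (\<lambda>c. c mod Q) (c ` {0..<Q}) {0..<Q}"
  proof -
    have "inj_on (\<lambda>b. c b mod Q) {0..<Q}"
      by (rule inj_onI, rule inj) auto
    moreover have "(\<lambda>b. c b mod Q) ` {0..<Q} \<subseteq> {0..<Q}"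
      using \<open>0 < Q\<close> by auto
    ultimately have "(\<lambda>b. c b mod Q) ` {0..<Q} = {0..<Q}"
      by (intro endo_inj_surj) simp_all
    then have "(\<lambda>c. c mod Q) ` (c ` {0..<Q}) = {0..<Q}"
      by (simp only: image_image)
    moreover have "inj_on (\<lambda>c. c mod Q) (c ` {0..<Q})"
      by (rule inj_onI, clarify, rule arg_cong[of _ _ c], rule inj) auto
    ultimately show ?thesis by (simp only: bij_betw_def)
  qed
qed

section \<open>The parameters of generalized Kautz digraphs\<close>

text \<open>
  That the number \<open>d * Q\<close> of blocks is again divisible by \<open>d\<close> makes the map from vertices to
  out-blocks compatible with positions inside blocks; this is where \<open>m \<ge> 2\<close> enters.
\<close>

locale kautz_block_digraph = block_digraph H d "d * Q" "\<lambda>x. d * Q - 1 - x mod (d * Q)"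
  for H d Q +
  assumes d_ge_2: "2 \<le> d" and Q_pos: "0 < Q"
begin

abbreviation out_block :: "nat \<Rightarrow> nat" where
  "out_block x \<equiv> d * Q - 1 - x mod (d * Q)"

text \<open>
  Blocks that agree modulo \<open>Q\<close> have the same out-blocks, and going through a block from left to
  right runs through an interval of length \<open>d\<close> of out-blocks from right to left.
\<close>

lemma out_block_eq: "out_block x = d * (Q - 1 - x div d mod Q) + (d - 1 - x mod d)"
proof -
  have "x mod (d * Q) = d * (x div d mod Q) + x mod d"
    by (rule mod_mult2_eq)
  moreover have "x div d mod Q < Q" "x mod d < d"
    using Q_pos d_pos by auto
  moreover have "d * Q - 1 - (d * a + r) = d * (Q - 1 - a) + (d - 1 - r)"
    if "a < Q" "r < d" for a r
  proof -
    obtain k where k: "Q = a + k + 1"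
      using \<open>a < Q\<close> by (metis add.commute add_Suc_right less_imp_add_positive plus_1_eq_Suc Suc_pred' add.assoc)
    show ?thesis
      using \<open>r < d\<close> by (simp add: k algebra_simps)
  qed
  ultimately show ?thesis by simp
qed

lemma out_block_div: "out_block x div d = Q - 1 - x div d mod Q"
  and out_block_mod: "out_block x mod d = d - 1 - x mod d"
  unfolding out_block_eq using d_pos by simp_all

lemma out_block_less: "out_block x < d * Q"
  using Q_pos d_pos by simp

text \<open>
  The in-neighbours of block \<open>c\<close>, numbered by \<open>k < d\<close>. They occupy the same position in their
  respective blocks, and these blocks are congruent modulo \<open>Q\<close>.
\<close>

definition in_nbr :: "nat \<Rightarrow> nat \<Rightarrow> nat" where
  "in_nbr k c = d * (k * Q + (Q - 1 - c div d)) + (d - 1 - c mod d)"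

lemma in_nbr_div: "in_nbr k c div d = k * Q + (Q - 1 - c div d)"
  and in_nbr_mod: "in_nbr k c mod d = d - 1 - c mod d"
  unfolding in_nbr_def using d_pos by simp_all

lemma in_nbr_less:
  assumes "k < d"
  shows "in_nbr k c < d * (d * Q)"
proof -
  have "k * Q + (Q - 1 - c div d) < Suc k * Q"
    using Q_pos by simp
  also have "\<dots> \<le> d * Q" using assms by (intro mult_le_mono1) simp
  finally show ?thesis
    using div_less_iff[of "in_nbr k c"] by (simp add: in_nbr_div)
qed

lemma out_block_in_nbr:
  assumes "c < d * Q"
  shows "out_block (in_nbr k c) = c"
proof -
  have "c div d < Q"
    using assms d_pos by (simp add: div_less_iff_less_mult mult.commute)
  have "in_nbr k c div d mod Q = Q - 1 - c div d"
    unfolding in_nbr_div mod_mult_self3 using Q_pos by (intro mod_less) simp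
  then have "out_block (in_nbr k c) div d = c div d"
    unfolding out_block_div using \<open>c div d < Q\<close> by simp
  moreover have "out_block (in_nbr k c) mod d = c mod d"
    unfolding out_block_mod in_nbr_mod using mod_less_divisor[OF d_pos, of c] by simp
  ultimately show ?thesis
    by (metis div_mult_mod_eq)
qed

text \<open>
  In-neighbours of one block share their position within their own blocks. So it is enough to
  omit position \<open>0\<close> from the first \<open>Q\<close> blocks and position \<open>1\<close> from all others: the
  in-neighbours \<open>in_nbr 0 c\<close> and \<open>in_nbr 1 c\<close> lie in the two different ranges, and at
  most one of them is omitted.
\<close>

lemma kautz_zero_forcing_rank_eqs:
  "zero_forcing_number H = (d - 1) * (d * Q)" "min_rank H = d * Q"
  "max_nullity H = (d - 1) * (d * Q)"
proof -
  define v where "v b = d * b + (if b < Q then 0 else 1)" for b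
  \<comment> \<open>The position of \<open>in_nbr k c\<close> is \<open>d - 1 - c mod d\<close>. If it is \<open>0\<close>, the in-neighbour among
    the first \<open>Q\<close> blocks is omitted, and the next one must force.\<close>
  define u where "u c = in_nbr (if c mod d = d - 1 then 1 else 0) c" for c
  have v: "v b div d = b" for b
    using d_ge_2 by (simp add: v_def)
  have v_mod: "v b mod d = (if b < Q then 0 else 1)" for b
    using d_ge_2 by (simp add: v_def)
  have u: "u c < d * (d * Q) \<and> out_block (u c) = c \<and> u c \<notin> v ` {0..<d * Q}" if c: "c < d * Q" for c
  proof (intro conjI notI)
    show "u c < d * (d * Q)" unfolding u_def using d_ge_2 by (intro in_nbr_less) auto
    show "out_block (u c) = c" unfolding u_def using c by (rule out_block_in_nbr)
    assume "u c \<in> v ` {0..<d * Q}"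
    then have uc: "u c = v (u c div d)" by (auto simp: v)
    have "u c mod d = (if u c div d < Q then 0 else 1)"
      using arg_cong[OF uc, of "\<lambda>x. x mod d"] unfolding v_mod .
    moreover have "c mod d = d - 1 \<or> d - 1 - c mod d \<noteq> 0"
      using mod_less_divisor[OF d_pos, of c] by linarith
    ultimately show False
      using Q_pos by (auto simp: u_def in_nbr_div in_nbr_mod split: if_splits)
  qed
  show "zero_forcing_number H = (d - 1) * (d * Q)" "min_rank H = d * Q"
    "max_nullity H = (d - 1) * (d * Q)"
    using zero_forcing_rank_eqs[OF d_ge_2 _ v u] Q_pos d_pos by auto
qed

text \<open>
  The set \<open>S\<close> consists of the vertices in the blocks of the common transversal \<open>C\<close> that point to a
  block outside \<open>C\<close>. As \<open>C\<close> is a transversal modulo \<open>Q\<close>, every block is the out-block of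
  just one vertex in the blocks of \<open>C\<close>; hence \<open>out_block\<close> is a bijection from \<open>S\<close> onto the
  complement of \<open>C\<close>. As \<open>C\<close> is a transversal of the intervals of out-blocks, each block of \<open>C\<close>
  has just one vertex outside \<open>S\<close>, which is left to be forced.
\<close>

lemma power_domination_number_eq: "power_domination_number H = (d - 1) * Q"
proof -
  obtain C where C: "C \<subseteq> {0..<d * Q}" and Cdiv: "bij_betw (\<lambda>c. c div d) C {0..<Q}"
    and Cmod: "bij_betw (\<lambda>c. c mod Q) C {0..<Q}"
    using common_transversal[OF d_pos Q_pos] .
  have finC: "finite C" using C by (rule finite_subset) simp
  have cardC: "card C = Q" using bij_betw_same_card[OF Cdiv] by simp
  define S where "S = {x. x div d \<in> C \<and> out_block x \<notin> C}"
  have SV: "S \<subseteq> pverts H"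
    using C by (auto simp: S_def pverts_eq)
  have eqI: "x = y" if "x div d \<in> C" "y div d \<in> C" "out_block x = out_block y" for x y
  proof -
    have lt: "x div d mod Q < Q" "y div d mod Q < Q" "x mod d < d" "y mod d < d"
      using Q_pos d_pos by auto
    have "Q - 1 - x div d mod Q = Q - 1 - y div d mod Q"
      using that(3) out_block_div by metis
    with lt have "x div d mod Q = y div d mod Q" by linarith
    with that Cmod have "x div d = y div d"
      by (auto simp: bij_betw_def dest: inj_onD)
    moreover have "d - 1 - x mod d = d - 1 - y mod d"
      using that(3) out_block_mod by metis
    with lt have "x mod d = y mod d" by linarith
    ultimately show "x = y" by (metis div_mult_mod_eq)
  qed
  have out_block_S: "out_block ` S = {0..<d * Q} - C"
  proof (intro subset_antisym subsetI)
    fix c assume "c \<in> out_block ` S"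
    then show "c \<in> {0..<d * Q} - C"
      using out_block_less by (auto simp: S_def)
  next
    fix c assume c: "c \<in> {0..<d * Q} - C"
    then have "Q - 1 - c div d \<in> {0..<Q}" using Q_pos by simp
    then obtain b where b: "b \<in> C" "b mod Q = Q - 1 - c div d"
      using Cmod unfolding bij_betw_def by (metis imageE)
    define x where "x = in_nbr (b div Q) c"
    have "x div d = b"
      unfolding x_def in_nbr_div b(2)[symmetric] by simp
    moreover have "out_block x = c"
      unfolding x_def using c by (intro out_block_in_nbr) simp
    ultimately show "c \<in> out_block ` S"
      using b c by (intro image_eqI[of _ _ x]) (auto simp: S_def)
  qed
  have "inj_on out_block S"
    by (rule inj_onI) (rule eqI, auto simp: S_def)
  then have "card S = card (out_block ` S)" by (simp add: card_image)
  also have "\<dots> = d * Q - Q"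
    unfolding out_block_S using C finC by (simp add: card_Diff_subset cardC)
  finally have cardS: "card S = (d - 1) * Q" by (simp add: diff_mult_distrib)

  define P where "P = closed_out_nbrs H S"
  have lt: "x < d * (d * Q)" if "x \<in> S" for x
    using that SV by (auto simp: pverts_eq)
  have P_iff: "y \<in> P \<longleftrightarrow> y \<in> S \<or> y div d \<notin> C" if y: "y < d * (d * Q)" for y
  proof -
    have "y \<in> P \<longleftrightarrow> y \<in> S \<or> y div d \<in> out_block ` S"
      using y by (auto simp: P_def closed_out_nbrs_def mem_out_nbrs) (blast intro: lt)
    then show ?thesis
      unfolding out_block_S using y by simp
  qed
  have PV: "P \<subseteq> pverts H"
    using SV by (auto simp: P_def closed_out_nbrs_def mem_out_nbrs pverts_eq)
  have rest: "y div d \<in> C \<and> out_block y \<in> C" if "y \<in> pverts H - P" for y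
    using that P_iff[of y] by (auto simp: pverts_eq S_def)
  have "force_step H P = pverts H"
  proof (rule force_step_eq_pverts[OF PV])
    show "inj_on (\<lambda>v. v div d) (pverts H - P)"
    proof (rule inj_onI)
      fix v w assume v: "v \<in> pverts H - P" and w: "w \<in> pverts H - P" and eq: "v div d = w div d"
      have "out_block v div d = out_block w div d"
        unfolding out_block_div eq ..
      with rest[OF v] rest[OF w] Cdiv have "out_block v = out_block w"
        by (auto simp: bij_betw_def dest: inj_onD)
      then show "v = w"
        using rest[OF v] rest[OF w] by (intro eqI[of v w]) simp_all
    qed
    fix v assume v: "v \<in> pverts H - P"
    define c where "c = v div d"
    have c: "c < d * Q" using v by (simp add: c_def pverts_eq)
    have forcer: "\<exists>u\<in>P. out_block u = c" if "k < d" "in_nbr k c div d \<notin> C" for k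
      using that in_nbr_less[OF that(1), of c] out_block_in_nbr[OF c, of k] P_iff by blast
    \<comment> \<open>The blocks of these two in-neighbours are distinct and congruent modulo \<open>Q\<close>, so one of
      them lies outside \<open>C\<close> and is dominated.\<close>
    have "in_nbr 0 c div d \<notin> C \<or> in_nbr 1 c div d \<notin> C"
    proof (rule ccontr)
      assume "\<not> ?thesis"
      moreover have "in_nbr 0 c div d mod Q = in_nbr 1 c div d mod Q"
        by (simp add: in_nbr_div)
      ultimately have "in_nbr 0 c div d = in_nbr 1 c div d"
        using Cmod by (auto simp: bij_betw_def dest: inj_onD)
      then show False using Q_pos by (simp add: in_nbr_div)
    qed
    then show "\<exists>u\<in>P. out_block u = v div d"
      using forcer[of 0] forcer[of 1] d_ge_2 by (auto simp: c_def)
  qed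
  then have "power_seq H S (Suc (Suc 0)) = pverts H"
    by (simp add: P_def)
  moreover have "S \<noteq> {}"
    using cardS d_ge_2 Q_pos by (intro notI) simp
  ultimately have "power_dominating_set H S"
    unfolding power_dominating_set_def using SV by blast
  moreover have "card S \<le> card S'" if "power_dominating_set H S'" for S'
  proof -
    have "d * ((d - 1) * Q) \<le> d * card S'"
      using power_dominating_set_card_ge[OF that] by (simp add: mult.left_commute)
    then show ?thesis using d_pos cardS by simp
  qed
  ultimately show ?thesis
    using power_domination_number_eqI[OF finite_pverts] cardS by metis
qed

end

theorem corollary5p4:
  fixes d n m :: nat
  assumes "d \<ge> 2" and "n \<ge> 1" and "m \<ge> 2"
  shows "zero_forcing_number (generalized_kautz d (d ^ m * n)) = (d - 1) * d ^ (m - 1) * n \<and>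
         max_nullity (generalized_kautz d (d ^ m * n)) = (d - 1) * d ^ (m - 1) * n \<and>
         min_rank (generalized_kautz d (d ^ m * n)) = d ^ (m - 1) * n \<and>
         power_domination_number (generalized_kautz d (d ^ m * n)) = (d - 1) * d ^ (m - 2) * n"
proof -
  define Q where "Q = d ^ (m - 2) * n"
  obtain k where k: "m = k + 2" using \<open>m \<ge> 2\<close> by (metis add.commute le_Suc_ex)
  have M: "d ^ (m - 1) * n = d * Q" and N: "d ^ m * n = d * (d * Q)"
    by (simp_all add: k Q_def mult.assoc)
  have "0 < Q" "0 < d" using assms by (auto simp: Q_def)
  interpret kautz_block_digraph "generalized_kautz d (d * (d * Q))" d Q
    by (rule kautz_block_digraph.intro[OF generalized_kautz_block_digraph],
        unfold kautz_block_digraph_axioms_def) (use \<open>0 < Q\<close> \<open>0 < d\<close> \<open>d \<ge> 2\<close> in auto)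
  show ?thesis
    using kautz_zero_forcing_rank_eqs power_domination_number_eq
    by (simp only: N M mult.assoc flip: Q_def)
qed

end
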